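(* With the notation of the context, the following limits hold: $$\lim_{c\to+\infty}\bar x_2(c)=\lim_{c\to+\infty}x_1^*(c)=+\infty,\qquad \lim_{c\to+\infty}\bar x_1(c)=\lim_{c\to+\infty}x_2^*(c)=-\infty,$$ and, for every $x\in\mathbb{R}$, $$\lim_{c\to+\infty}V_1^c(x)=\frac{x-s_1}{\rho},\qquad \lim_{c\to+\infty}V_2^c(x)=\frac{s_2-x}{\rho}.$$
   Context: Fix $\rho,\sigma>0$, $s_1<s_2$, $\tilde c\ge0$, $\lambda\ge\tilde\lambda\ge0$ with $1-\lambda\rho>0$, and $\tilde s\in\mathbb{R}$; the parameter $c$ varies in $]\tilde c,\infty[$. Set $\theta=\sqrt{2\rho/\sigma^2}$ and $\eta=(1-\lambda\rho)/\rho>0$. For $c>0$ let $\xi(c)$ be the unique zero in $(0,\eta)$ of $F(x)=2x+\theta c-\eta\log\frac{\eta+x}{\eta-x}$, and let $$\Gamma(c)=\frac{\theta(c-\tilde c)}{4\xi(c)}+\frac{\theta c(\lambda-\tilde\lambda)}{4\eta\xi(c)}+\frac{\lambda-\tilde\lambda}{2\eta}.$$ For $i,j\in\{1,2\}$ set (writing $\xi=\xi(c)$, $\Gamma=\Gamma(c)$) $$\bar x_i(c)=\tilde s+\frac{(-1)^i}{\theta}\log\Big[\sqrt{\tfrac{\eta+\xi}{\eta-\xi}}\big(\sqrt{\Gamma+1}+\sqrt\Gamma\big)\Big],\qquad x_i^*(c)=\tilde s+\frac{(-1)^i}{\theta}\log\Big[\sqrt{\tfrac{\eta-\xi}{\eta+\xi}}\big(\sqrt{\Gamma+1}+\sqrt\Gamma\big)\Big],$$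 $$A_{ij}(c)=e^{(-1)^j\theta\tilde s}\,\frac{\sqrt{\eta^2-\xi^2}}{2\theta}\Big((-1)^{i+j+1}\sqrt{\Gamma+1}-\sqrt\Gamma\Big).$$ With $\varphi_2(x)=A_{21}(c)e^{\theta x}+A_{22}(c)e^{-\theta x}+(s_2-x)/\rho$, define (dependence of $\bar x_i,x_i^*$ on $c$ omitted) $$V_2^c(x)=\begin{cases}\varphi_2(x_1^* )+\tilde c+\tilde\lambda(x_1^*-x),&x\le\bar x_1,\\ \varphi_2(x),&\bar x_1<x<\bar x_2,\\ \varphi_2(x_2^* )-c-\lambda(x-x_2^* ),&x\ge\bar x_2,\end{cases}\qquad V_1^c(x)=V_2^c(2\tilde s-x)+\frac{2\tilde s-(s_1+s_2)}{\rho}.$$ These are the payoff functions of the two players at the Nash equilibrium of index $\tilde s$ in an impulse game on a scaled Brownian motion $\sigma W$ with running payoffs $x-s_1$ and $s_2-x$, discount rate $\rho$, intervention cost $c+\lambda|\delta|$ and gain $\tilde c+\tilde\lambda|\delta|$ for the opponent; player 1 shifts the state to $x_1^*$ when it is $\le\bar x_1$, player 2 shifts it to $x_2^*$ when it is $\ge\bar x_2$. *)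

theory Defs
  imports Complex_Main
begin

text \<open>
  Parameters are passed explicitly: the discount rate \<open>\<rho>\<close>, the volatility \<open>\<sigma>\<close>, the intervention
  cost \<open>c + lam |\<delta>|\<close>, the opponent's gain \<open>ct + lamt |\<delta>|\<close>, and the index \<open>st\<close> of the Nash equilibrium;
  the suffix \<open>t\<close> stands for a tilde in the source.  The indices \<open>i\<close>, \<open>j\<close> are natural numbers of
  which only 1 and 2 are meaningful.
\<close>

definition ne_theta :: "real \<Rightarrow> real \<Rightarrow> real" where
  "ne_theta \<rho> \<sigma> = sqrt (2 * \<rho> / \<sigma>^2)"

definition ne_eta :: "real \<Rightarrow> real \<Rightarrow> real" where
  "ne_eta \<rho> lam = (1 - lam * \<rho>) / \<rho>"

definition ne_F :: "real \<Rightarrow> real \<Rightarrow> real \<Rightarrow> real \<Rightarrow> real \<Rightarrow> real" where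
  "ne_F \<rho> \<sigma> lam c x =
     2 * x + ne_theta \<rho> \<sigma> * c
       - ne_eta \<rho> lam * ln ((ne_eta \<rho> lam + x) / (ne_eta \<rho> lam - x))"

text \<open>
  The description below is proper for \<open>\<rho>, \<sigma>, c > 0\<close> and \<open>1 - lam \<rho> > 0\<close>: \<open>F\<close> is strictly decreasing on
  \<open>(0, \<eta>)\<close>, with limits \<open>\<theta> c > 0\<close> at \<open>0\<close> and \<open>-\<infinity>\<close> at \<open>\<eta>\<close>.
\<close>

definition ne_xi :: "real \<Rightarrow> real \<Rightarrow> real \<Rightarrow> real \<Rightarrow> real" where
  "ne_xi \<rho> \<sigma> lam c = (THE x. 0 < x \<and> x < ne_eta \<rho> lam \<and> ne_F \<rho> \<sigma> lam c x = 0)"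

definition ne_Gamma :: "real \<Rightarrow> real \<Rightarrow> real \<Rightarrow> real \<Rightarrow> real \<Rightarrow> real \<Rightarrow> real" where
  "ne_Gamma \<rho> \<sigma> lam lamt ct c =
     ne_theta \<rho> \<sigma> * (c - ct) / (4 * ne_xi \<rho> \<sigma> lam c)
     + ne_theta \<rho> \<sigma> * c * (lam - lamt) / (4 * ne_eta \<rho> lam * ne_xi \<rho> \<sigma> lam c)
     + (lam - lamt) / (2 * ne_eta \<rho> lam)"

definition ne_xbar ::
  "real \<Rightarrow> real \<Rightarrow> real \<Rightarrow> real \<Rightarrow> real \<Rightarrow> real \<Rightarrow> nat \<Rightarrow> real \<Rightarrow> real" where
  "ne_xbar \<rho> \<sigma> lam lamt ct st i c =
     (let \<theta> = ne_theta \<rho> \<sigma>; \<eta> = ne_eta \<rho> lam; \<xi> = ne_xi \<rho> \<sigma> lam c; \<Gamma> = ne_Gamma \<rho> \<sigma> lam lamt ct c in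
      st + (-1)^i / \<theta> * ln (sqrt ((\<eta> + \<xi>) / (\<eta> - \<xi>)) * (sqrt (\<Gamma> + 1) + sqrt \<Gamma>)))"

definition ne_xstar ::
  "real \<Rightarrow> real \<Rightarrow> real \<Rightarrow> real \<Rightarrow> real \<Rightarrow> real \<Rightarrow> nat \<Rightarrow> real \<Rightarrow> real" where
  "ne_xstar \<rho> \<sigma> lam lamt ct st i c =
     (let \<theta> = ne_theta \<rho> \<sigma>; \<eta> = ne_eta \<rho> lam; \<xi> = ne_xi \<rho> \<sigma> lam c; \<Gamma> = ne_Gamma \<rho> \<sigma> lam lamt ct c in
      st + (-1)^i / \<theta> * ln (sqrt ((\<eta> - \<xi>) / (\<eta> + \<xi>)) * (sqrt (\<Gamma> + 1) + sqrt \<Gamma>)))"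

definition ne_A ::
  "real \<Rightarrow> real \<Rightarrow> real \<Rightarrow> real \<Rightarrow> real \<Rightarrow> real \<Rightarrow> nat \<Rightarrow> nat \<Rightarrow> real \<Rightarrow> real" where
  "ne_A \<rho> \<sigma> lam lamt ct st i j c =
     (let \<theta> = ne_theta \<rho> \<sigma>; \<eta> = ne_eta \<rho> lam; \<xi> = ne_xi \<rho> \<sigma> lam c; \<Gamma> = ne_Gamma \<rho> \<sigma> lam lamt ct c in
      exp ((-1)^j * \<theta> * st) * (sqrt (\<eta>^2 - \<xi>^2) / (2 * \<theta>))
        * ((-1)^(i + j + 1) * sqrt (\<Gamma> + 1) - sqrt \<Gamma>))"

definition ne_phi2 ::
  "real \<Rightarrow> real \<Rightarrow> real \<Rightarrow> real \<Rightarrow> real \<Rightarrow> real \<Rightarrow> real \<Rightarrow> real \<Rightarrow> real \<Rightarrow> real" where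
  "ne_phi2 \<rho> \<sigma> lam lamt ct st s2 c x =
     ne_A \<rho> \<sigma> lam lamt ct st 2 1 c * exp (ne_theta \<rho> \<sigma> * x)
     + ne_A \<rho> \<sigma> lam lamt ct st 2 2 c * exp (- (ne_theta \<rho> \<sigma> * x))
     + (s2 - x) / \<rho>"

definition ne_V2 ::
  "real \<Rightarrow> real \<Rightarrow> real \<Rightarrow> real \<Rightarrow> real \<Rightarrow> real \<Rightarrow> real \<Rightarrow> real \<Rightarrow> real \<Rightarrow> real" where
  "ne_V2 \<rho> \<sigma> lam lamt ct st s2 c x =
     (let \<phi> = ne_phi2 \<rho> \<sigma> lam lamt ct st s2 c;
          xbar = (\<lambda>i. ne_xbar \<rho> \<sigma> lam lamt ct st i c);
          xstar = (\<lambda>i. ne_xstar \<rho> \<sigma> lam lamt ct st i c) in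
      if x \<le> xbar 1 then \<phi> (xstar 1) + ct + lamt * (xstar 1 - x)
      else if x < xbar 2 then \<phi> x
      else \<phi> (xstar 2) - c - lam * (x - xstar 2))"

definition ne_V1 ::
  "real \<Rightarrow> real \<Rightarrow> real \<Rightarrow> real \<Rightarrow> real \<Rightarrow> real \<Rightarrow> real \<Rightarrow> real \<Rightarrow> real \<Rightarrow> real \<Rightarrow> real" where
  "ne_V1 \<rho> \<sigma> lam lamt ct st s1 s2 c x =
     ne_V2 \<rho> \<sigma> lam lamt ct st s2 c (2 * st - x) + (2 * st - (s1 + s2)) / \<rho>"

end

theory Submission
  imports Defs "HOL-Real_Asymp.Real_Asymp"
begin

text \<open>
  Everything is governed by the two numbers \<open>r = sqrt ((\<eta> - \<xi>) / (\<eta> + \<xi>))\<close> and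
  \<open>w = sqrt (\<Gamma> + 1) + sqrt \<Gamma>\<close>.  The equation \<open>F \<xi> = 0\<close> says exactly that
  \<open>r = exp (- (2 * \<xi> + \<theta> * c) / (2 * \<eta>))\<close>, so \<open>r\<close> decays exponentially in \<open>c\<close>.  In particular
  \<open>\<xi>\<close> tends to \<open>\<eta>\<close>, hence stays away from \<open>0\<close>, and \<open>\<Gamma>\<close>, whose denominators involve \<open>\<xi>\<close>,
  grows at most linearly; so does \<open>w\<close>.  Therefore \<open>r * w\<close> tends to \<open>0\<close> (\<open>rw_tendsto_0\<close>), and this
  single limit carries the whole result.

  For the thresholds: \<open>\<theta> * (xstar - st)\<close> is \<open>ln (r * w)\<close> up to sign, which tends to \<open>-\<infinity>\<close>, and
  \<open>\<theta> * (xbar - st)\<close> is \<open>ln (w / r)\<close> up to sign, which is at least \<open>- ln (r * w)\<close> because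
  \<open>w \<ge> 1\<close>.  For the payoffs: a fixed state lies strictly between the thresholds \<open>xbar\<close> once \<open>c\<close> is
  large, so only the middle branch of the payoff matters, and there the coefficients of both
  exponentials are bounded by a constant times \<open>sqrt (\<eta>^2 - \<xi>^2) * w = (\<eta> + \<xi>) * (r * w)\<close>.
\<close>

section \<open>The zero of F\<close>

locale impulse_game =
  fixes \<rho> \<sigma> ct lam lamt st :: real
  assumes rho_pos: "\<rho> > 0" and sigma_pos: "\<sigma> > 0" and ct_nonneg: "ct \<ge> 0"
    and lamt_le: "lam \<ge> lamt" and lam_rho_less: "1 - lam * \<rho> > 0"
begin

abbreviation "\<theta> \<equiv> ne_theta \<rho> \<sigma>"
abbreviation "\<eta> \<equiv> ne_eta \<rho> lam"
abbreviation "F \<equiv> ne_F \<rho> \<sigma> lam"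
abbreviation "\<xi> \<equiv> ne_xi \<rho> \<sigma> lam"
abbreviation "\<Gamma> \<equiv> ne_Gamma \<rho> \<sigma> lam lamt ct"

definition r :: "real \<Rightarrow> real" where
  "r c = sqrt ((\<eta> - \<xi> c) / (\<eta> + \<xi> c))"

definition w :: "real \<Rightarrow> real" where
  "w c = sqrt (\<Gamma> c + 1) + sqrt (\<Gamma> c)"

lemma theta_pos: "\<theta> > 0"
  using rho_pos sigma_pos by (simp add: ne_theta_def)

lemma eta_pos: "\<eta> > 0"
  using rho_pos lam_rho_less by (simp add: ne_eta_def)

lemma F_has_derivative:
  assumes "0 \<le> x" "x < \<eta>"
  shows "(F c has_real_derivative (2 - 2 * \<eta>^2 / (\<eta>^2 - x^2))) (at x)"
proof -
  have pos: "\<eta> + x > 0" "\<eta> - x > 0" using assms eta_pos by auto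
  have "((\<lambda>x. 2 * x + \<theta> * c - \<eta> * ln ((\<eta> + x) / (\<eta> - x))) has_real_derivative
      2 - \<eta> * (((1 * (\<eta> - x) - (\<eta> + x) * (-1)) / ((\<eta> - x) * (\<eta> - x)))
             * (1 / ((\<eta> + x) / (\<eta> - x))))) (at x)"
    using pos by (auto intro!: derivative_eq_intros simp: mult_ac)
  moreover have "\<eta> * (((1 * (\<eta> - x) - (\<eta> + x) * (-1)) / ((\<eta> - x) * (\<eta> - x)))
             * (1 / ((\<eta> + x) / (\<eta> - x)))) = 2 * \<eta>^2 / ((\<eta> + x) * (\<eta> - x))"
  proof -
    have quotient: "\<eta> * (2 * \<eta> / (q * q) * (1 / (p / q))) = 2 * \<eta>^2 / (p * q)"
      if "p > 0" "q > 0" for p q :: real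
      using that by (simp add: field_simps power2_eq_square)
    have "1 * (\<eta> - x) - (\<eta> + x) * (-1) = 2 * \<eta>" by simp
    then show ?thesis using quotient [OF pos] by (simp only:)
  qed
  moreover have "(\<eta> + x) * (\<eta> - x) = \<eta>^2 - x^2"
    by (simp add: power2_eq_square algebra_simps)
  ultimately show ?thesis by (simp add: ne_F_def [abs_def])
qed

text \<open>The derivative of \<open>F\<close> is \<open>- 2 * x^2 / (\<eta>^2 - x^2)\<close>.\<close>

lemma F_strict_decreasing:
  assumes "0 < x" "x < y" "y < \<eta>"
  shows "F c y < F c x"
proof (rule DERIV_neg_imp_decreasing [OF \<open>x < y\<close>])
  fix z assume z: "x \<le> z" "z \<le> y"
  then have "0 < z" "z < \<eta>" using assms by auto
  then have "z^2 < \<eta>^2" "0 < z^2" by (auto intro: power_strict_mono)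
  then have "2 - 2 * \<eta>^2 / (\<eta>^2 - z^2) < 0" by (simp add: field_simps)
  then show "\<exists>d. (F c has_real_derivative d) (at z) \<and> d < 0"
    using F_has_derivative \<open>0 < z\<close> \<open>z < \<eta>\<close> by (meson less_imp_le)
qed

lemma F_zero_exists:
  assumes "c > 0"
  shows "\<exists>x. 0 < x \<and> x < \<eta> \<and> F c x = 0"
proof -
  \<comment> \<open>At \<open>b = \<eta> * tanh (M / 2)\<close> the logarithm equals \<open>M\<close>, and \<open>M\<close> is chosen to make
    \<open>F c b = 2 * b - 2 * \<eta> < 0\<close>.\<close>
  define M where "M = (2 * \<eta> + \<theta> * c) / \<eta>"
  define b where "b = \<eta> * (exp M - 1) / (exp M + 1)"
  have "M > 0" using eta_pos theta_pos assms by (auto simp: M_def intro!: divide_pos_pos add_pos_pos)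
  then have "exp M > 1" by simp
  then have "exp M + 1 > 0" by linarith
  have complements: "\<eta> + b = 2 * \<eta> * exp M / (exp M + 1)" "\<eta> - b = 2 * \<eta> / (exp M + 1)"
    using \<open>exp M + 1 > 0\<close> by (simp_all add: b_def field_simps)
  have b: "0 < b" "b < \<eta>"
  proof -
    show "0 < b" unfolding b_def
      using eta_pos \<open>exp M > 1\<close> \<open>exp M + 1 > 0\<close> by (intro divide_pos_pos mult_pos_pos) auto
    have "\<eta> - b > 0" unfolding complements
      using eta_pos \<open>exp M + 1 > 0\<close> by simp
    then show "b < \<eta>" by simp
  qed
  have "(\<eta> + b) / (\<eta> - b) = exp M"
    unfolding complements
    using eta_pos \<open>exp M + 1 > 0\<close> by simp
  then have "F c b = 2 * b - 2 * \<eta>"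
    using eta_pos by (simp add: ne_F_def M_def)
  then have neg: "F c b < 0" using b by simp
  have F0: "F c 0 > 0" using eta_pos theta_pos assms by (simp add: ne_F_def)
  have "\<exists>x\<ge>0. x \<le> b \<and> F c x = 0"
  proof (rule IVT2)
    show "\<forall>x. 0 \<le> x \<and> x \<le> b \<longrightarrow> isCont (F c) x"
      using F_has_derivative b(2) DERIV_isCont by (meson le_less_trans)
  qed (use neg F0 b in auto)
  then obtain x where x: "0 \<le> x" "x \<le> b" "F c x = 0" by auto
  then have "x \<noteq> 0" using F0 by auto
  then show ?thesis using x b by (intro exI [of _ x]) auto
qed

lemma xi_zero_of_F:
  assumes "c > 0"
  shows "0 < \<xi> c" "\<xi> c < \<eta>" "F c (\<xi> c) = 0"
proof -
  have "\<exists>!x. 0 < x \<and> x < \<eta> \<and> F c x = 0"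
    using F_zero_exists [OF assms] F_strict_decreasing
    by (metis less_irrefl linorder_neqE_linordered_idom)
  then have "0 < \<xi> c \<and> \<xi> c < \<eta> \<and> F c (\<xi> c) = 0"
    unfolding ne_xi_def by (rule theI')
  then show "0 < \<xi> c" "\<xi> c < \<eta>" "F c (\<xi> c) = 0" by auto
qed

section \<open>Growth estimates for large cost\<close>

lemma r_pos: "c > 0 \<Longrightarrow> r c > 0"
  using xi_zero_of_F [of c] eta_pos by (simp add: r_def)

lemma inverse_r: "sqrt ((\<eta> + \<xi> c) / (\<eta> - \<xi> c)) = inverse (r c)"
  by (simp add: r_def flip: real_sqrt_inverse)

text \<open>The equation \<open>F \<xi> = 0\<close>, solved for the logarithm and exponentiated.\<close>

lemma r_eq_exp:
  assumes "c > 0"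
  shows "r c = exp (- ((2 * \<xi> c + \<theta> * c) / (2 * \<eta>)))"
proof -
  note xi = xi_zero_of_F [OF assms]
  have pos: "(\<eta> + \<xi> c) / (\<eta> - \<xi> c) > 0" using xi eta_pos by simp
  have "- ln (r c) = ln (inverse (r c))"
    using r_pos [OF assms] by (simp add: ln_inverse)
  also have "\<dots> = ln ((\<eta> + \<xi> c) / (\<eta> - \<xi> c)) / 2"
    using pos by (simp add: ln_sqrt flip: inverse_r)
  also have "\<dots> = (2 * \<xi> c + \<theta> * c) / (2 * \<eta>)"
    using xi(3) eta_pos by (simp add: ne_F_def field_simps)
  finally have "ln (r c) = - ((2 * \<xi> c + \<theta> * c) / (2 * \<eta>))" by simp
  then show ?thesis using r_pos [OF assms] by (metis exp_ln)
qed

lemma r_le_exp: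
  assumes "c > 0"
  shows "r c \<le> exp (- (\<theta> / (2 * \<eta>)) * c)"
  using xi_zero_of_F [OF assms] eta_pos by (simp add: r_eq_exp [OF assms] field_simps)

lemma r_tendsto_0: "(r \<longlongrightarrow> 0) at_top"
proof (rule tendsto_sandwich [OF _ _ tendsto_const])
  define k where "k = \<theta> / (2 * \<eta>)"
  have "k > 0" using theta_pos eta_pos by (simp add: k_def)
  then show "((\<lambda>c. exp (- k * c)) \<longlongrightarrow> 0) at_top" by real_asymp
  show "eventually (\<lambda>c. 0 \<le> r c) at_top"
    using eventually_gt_at_top [of 0] by eventually_elim (simp add: r_pos less_imp_le)
  show "eventually (\<lambda>c. r c \<le> exp (- k * c)) at_top"
    using eventually_gt_at_top [of 0] by eventually_elim (simp only: r_le_exp k_def)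
qed

text \<open>
  Once \<open>r \<le> 1/2\<close>, the definition of \<open>r\<close> gives \<open>\<eta> - \<xi> \<le> (\<eta> + \<xi>) / 4 \<le> \<eta> / 2\<close>.
\<close>

lemma xi_ge_half_eta: "eventually (\<lambda>c. \<xi> c \<ge> \<eta> / 2) at_top"
proof -
  have "eventually (\<lambda>c. r c < 1/2) at_top"
    using order_tendstoD(2) [OF r_tendsto_0, of "1/2"] by simp
  then show ?thesis using eventually_gt_at_top [of 0]
  proof eventually_elim
    case (elim c)
    note xi = xi_zero_of_F [OF elim(2)]
    have "(\<eta> - \<xi> c) / (\<eta> + \<xi> c) = (r c)^2" using xi eta_pos by (simp add: r_def)
    also have "\<dots> \<le> (1/2)^2" using elim r_pos [of c] by (intro power_mono) auto
    finally show ?case using xi eta_pos by (simp add: field_simps power2_eq_square)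
  qed
qed

lemma Gamma_nonneg:
  assumes "c > 0" "c \<ge> ct"
  shows "\<Gamma> c \<ge> 0"
  using xi_zero_of_F [OF assms(1)] eta_pos theta_pos assms lamt_le
  by (auto simp: ne_Gamma_def intro!: add_nonneg_nonneg divide_nonneg_nonneg mult_nonneg_nonneg)

lemma Gamma_le_linear:
  "\<exists>a b. eventually (\<lambda>c. \<Gamma> c \<le> a * c + b) at_top"
proof (intro exI)
  let ?a = "\<theta> / (2 * \<eta>) + \<theta> * (lam - lamt) / (2 * \<eta> * \<eta>)"
  let ?b = "(lam - lamt) / (2 * \<eta>)"
  show "eventually (\<lambda>c. \<Gamma> c \<le> ?a * c + ?b) at_top"
    using xi_ge_half_eta eventually_gt_at_top [of 0]
  proof eventually_elim
    case (elim c)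
    have "\<theta> * (c - ct) / (4 * \<xi> c) \<le> \<theta> * c / (4 * (\<eta> / 2))"
      using elim eta_pos theta_pos ct_nonneg by (intro frac_le mult_left_mono mult_nonneg_nonneg) auto
    moreover have "\<theta> * c * (lam - lamt) / (4 * \<eta> * \<xi> c)
        \<le> \<theta> * c * (lam - lamt) / (4 * \<eta> * (\<eta> / 2))"
      using elim eta_pos theta_pos lamt_le
      by (intro frac_le mult_left_mono mult_nonneg_nonneg) auto
    moreover have "\<theta> * c / (4 * (\<eta> / 2)) + \<theta> * c * (lam - lamt) / (4 * \<eta> * (\<eta> / 2)) = ?a * c"
      using eta_pos by (simp add: field_simps)
    ultimately show ?case unfolding ne_Gamma_def by linarith
  qed
qed

lemma w_ge_1:
  assumes "c > 0" "c \<ge> ct"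
  shows "w c \<ge> 1"
proof -
  have "sqrt (\<Gamma> c + 1) \<ge> 1" "sqrt (\<Gamma> c) \<ge> 0" using Gamma_nonneg [OF assms] by simp_all
  then show ?thesis unfolding w_def by linarith
qed

lemma w_le:
  assumes "c > 0" "c \<ge> ct"
  shows "w c \<le> 2 * (\<Gamma> c + 1)"
proof -
  have "sqrt (\<Gamma> c + 1) \<le> \<Gamma> c + 1"
    using Gamma_nonneg [OF assms] by (intro real_le_lsqrt) (auto simp: power2_eq_square algebra_simps)
  moreover have "sqrt (\<Gamma> c) \<le> sqrt (\<Gamma> c + 1)" by simp
  ultimately have "sqrt (\<Gamma> c + 1) + sqrt (\<Gamma> c) \<le> (\<Gamma> c + 1) + (\<Gamma> c + 1)"
    by (meson add_mono order_trans)
  then show ?thesis by (simp add: w_def)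
qed

lemma eventually_large: "eventually (\<lambda>c. c > 0 \<and> c \<ge> ct) at_top"
  using eventually_gt_at_top [of 0] eventually_ge_at_top [of ct] by eventually_elim simp

text \<open>The exponential decay of \<open>r\<close> beats the linear growth of \<open>\<Gamma>\<close>.\<close>

lemma rw_tendsto_0: "((\<lambda>c. r c * w c) \<longlongrightarrow> 0) at_top"
proof -
  obtain a b where Gamma_le: "eventually (\<lambda>c. \<Gamma> c \<le> a * c + b) at_top"
    using Gamma_le_linear by blast
  define k where "k = \<theta> / (2 * \<eta>)"
  have "k > 0" using theta_pos eta_pos by (simp add: k_def)
  show ?thesis
  proof (rule tendsto_sandwich [OF _ _ tendsto_const])
    have "((\<lambda>c. c * exp (- k * c)) \<longlongrightarrow> 0) at_top" "((\<lambda>c. exp (- k * c)) \<longlongrightarrow> 0) at_top"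
      using \<open>k > 0\<close> by real_asymp+
    then have "((\<lambda>c. 2 * a * (c * exp (- k * c)) + 2 * (b + 1) * exp (- k * c))
        \<longlongrightarrow> 2 * a * 0 + 2 * (b + 1) * 0) at_top"
      by (intro tendsto_intros)
    then show "((\<lambda>c. exp (- k * c) * (2 * (a * c + b + 1))) \<longlongrightarrow> 0) at_top"
      by (simp add: algebra_simps)
    show "eventually (\<lambda>c. 0 \<le> r c * w c) at_top"
      using eventually_large
    proof eventually_elim
      case (elim c)
      then have "r c > 0" "w c \<ge> 1" using r_pos w_ge_1 by auto
      then show ?case by simp
    qed
    show "eventually (\<lambda>c. r c * w c \<le> exp (- k * c) * (2 * (a * c + b + 1))) at_top"
      using eventually_large Gamma_le
    proof eventually_elim
      case (elim c)
      have "r c \<le> exp (- k * c)" using elim r_le_exp by (simp only: k_def)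
      moreover have "w c \<le> 2 * (a * c + b + 1)" "w c \<ge> 1"
        using elim w_le [of c] w_ge_1 [of c] by auto
      ultimately show ?case by (intro mult_mono) auto
    qed
  qed
qed

section \<open>The thresholds and target states\<close>

lemma ln_rw_at_bot: "filterlim (\<lambda>c. ln (r c * w c)) at_bot at_top"
proof (rule filterlim_compose [OF ln_at_0])
  have "eventually (\<lambda>c. r c * w c \<in> {0<..}) at_top"
    using eventually_large
  proof eventually_elim
    case (elim c)
    then have "r c > 0" "w c \<ge> 1" using r_pos w_ge_1 by auto
    then show ?case by simp
  qed
  then show "filterlim (\<lambda>c. r c * w c) (at_right 0) at_top"
    using rw_tendsto_0 by (intro filterlim_atI' tendsto_imp_filterlim_at_right) (auto elim: eventually_mono)
qed

lemma ln_w_over_r_at_top: "filterlim (\<lambda>c. ln (inverse (r c) * w c)) at_top at_top"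
proof (rule filterlim_at_top_mono)
  show "filterlim (\<lambda>c. - ln (r c * w c)) at_top at_top"
    using ln_rw_at_bot by (simp add: filterlim_uminus_at_bot)
  show "eventually (\<lambda>c. - ln (r c * w c) \<le> ln (inverse (r c) * w c)) at_top"
    using eventually_large
  proof eventually_elim
    case (elim c)
    then have "r c > 0" "w c \<ge> 1" using r_pos w_ge_1 by auto
    moreover have "ln (w c) \<ge> 0" using \<open>w c \<ge> 1\<close> by simp
    ultimately show ?case by (simp add: ln_mult ln_inverse)
  qed
qed

lemma filterlim_affine_at_top:
  assumes "filterlim f at_top (at_top :: real filter)"
  shows "filterlim (\<lambda>c. st + f c / \<theta>) at_top at_top"
    and "filterlim (\<lambda>c. st - f c / \<theta>) at_bot at_top"
proof -
  have *: "filterlim (\<lambda>c. 1 / \<theta> * f c) at_top at_top"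
    using theta_pos by (intro filterlim_tendsto_pos_mult_at_top [OF tendsto_const _ assms]) simp
  then show "filterlim (\<lambda>c. st + f c / \<theta>) at_top at_top"
    using filterlim_tendsto_add_at_top [OF tendsto_const, of _ _ st] by simp
  have "filterlim (\<lambda>c. - st + 1 / \<theta> * f c) at_top at_top"
    using * by (intro filterlim_tendsto_add_at_top [OF tendsto_const])
  then show "filterlim (\<lambda>c. st - f c / \<theta>) at_bot at_top"
    by (simp add: filterlim_uminus_at_bot algebra_simps)
qed

lemma xbar_eq:
  "ne_xbar \<rho> \<sigma> lam lamt ct st 1 c = st - ln (inverse (r c) * w c) / \<theta>"
  "ne_xbar \<rho> \<sigma> lam lamt ct st 2 c = st + ln (inverse (r c) * w c) / \<theta>"
  by (simp_all add: ne_xbar_def Let_def inverse_r w_def)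

lemma xstar_eq:
  "ne_xstar \<rho> \<sigma> lam lamt ct st 1 c = st + (- ln (r c * w c)) / \<theta>"
  "ne_xstar \<rho> \<sigma> lam lamt ct st 2 c = st - (- ln (r c * w c)) / \<theta>"
  by (simp_all add: ne_xstar_def Let_def r_def w_def)

lemma xbar_limits:
  "filterlim (ne_xbar \<rho> \<sigma> lam lamt ct st 1) at_bot at_top"
  "filterlim (ne_xbar \<rho> \<sigma> lam lamt ct st 2) at_top at_top"
  unfolding xbar_eq [abs_def] by (rule filterlim_affine_at_top [OF ln_w_over_r_at_top])+

lemma xstar_limits:
  "filterlim (ne_xstar \<rho> \<sigma> lam lamt ct st 1) at_top at_top"
  "filterlim (ne_xstar \<rho> \<sigma> lam lamt ct st 2) at_bot at_top"
proof -
  have "filterlim (\<lambda>c. - ln (r c * w c)) at_top at_top"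
    using ln_rw_at_bot by (simp add: filterlim_uminus_at_bot)
  then show "filterlim (ne_xstar \<rho> \<sigma> lam lamt ct st 1) at_top at_top"
    "filterlim (ne_xstar \<rho> \<sigma> lam lamt ct st 2) at_bot at_top"
    unfolding xstar_eq [abs_def] by (rule filterlim_affine_at_top)+
qed

section \<open>The payoffs\<close>

text \<open>
  Here \<open>sqrt (\<eta>^2 - \<xi>^2) = (\<eta> + \<xi>) * r\<close> with \<open>\<xi> < \<eta>\<close>, and the last factor of the coefficient, a signed
  sum of \<open>sqrt (\<Gamma> + 1)\<close> and \<open>sqrt \<Gamma>\<close>, is at most \<open>w\<close> in absolute value.
\<close>

lemma A_bound:
  assumes "c > 0" "c \<ge> ct"
  shows "\<bar>ne_A \<rho> \<sigma> lam lamt ct st i j c\<bar> \<le> exp ((-1)^j * \<theta> * st) * (\<eta> / \<theta>) * (r c * w c)"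
proof -
  note xi = xi_zero_of_F [OF assms(1)]
  have "\<eta>^2 - \<xi> c^2 = (\<eta> + \<xi> c)^2 * ((\<eta> - \<xi> c) / (\<eta> + \<xi> c))"
    using xi eta_pos by (simp add: power2_eq_square field_simps)
  then have sq: "sqrt (\<eta>^2 - \<xi> c^2) = (\<eta> + \<xi> c) * r c"
    using xi eta_pos by (simp add: real_sqrt_mult r_def del: times_divide_eq_right)
  define B where "B = (-1)^(i + j + 1) * sqrt (\<Gamma> c + 1) - sqrt (\<Gamma> c)"
  have "\<bar>B\<bar> \<le> \<bar>(-1)^(i + j + 1) * sqrt (\<Gamma> c + 1)\<bar> + \<bar>sqrt (\<Gamma> c)\<bar>"
    unfolding B_def by (rule abs_triangle_ineq4)
  also have "\<dots> = w c"
    using Gamma_nonneg [OF assms] by (simp add: w_def abs_mult power_abs)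
  finally have B: "\<bar>B\<bar> \<le> w c" .
  have "(\<eta> + \<xi> c) * r c / (2 * \<theta>) \<le> (2 * \<eta>) * r c / (2 * \<theta>)"
    using xi theta_pos r_pos [OF assms(1)] by (intro divide_right_mono mult_right_mono) auto
  then have C: "(\<eta> + \<xi> c) * r c / (2 * \<theta>) \<le> \<eta> / \<theta> * r c" by simp
  have C0: "0 \<le> (\<eta> + \<xi> c) * r c / (2 * \<theta>)"
    using xi eta_pos theta_pos r_pos [OF assms(1)] by simp
  have "ne_A \<rho> \<sigma> lam lamt ct st i j c
      = exp ((-1)^j * \<theta> * st) * ((\<eta> + \<xi> c) * r c / (2 * \<theta>) * B)"
    by (simp add: ne_A_def Let_def sq B_def)
  then have "\<bar>ne_A \<rho> \<sigma> lam lamt ct st i j c\<bar>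
      = exp ((-1)^j * \<theta> * st) * ((\<eta> + \<xi> c) * r c / (2 * \<theta>) * \<bar>B\<bar>)"
    using C0 by (simp only: abs_mult abs_exp_cancel abs_of_nonneg)
  also have "\<dots> \<le> exp ((-1)^j * \<theta> * st) * (\<eta> / \<theta> * r c * w c)"
    using B C C0 by (intro mult_left_mono mult_mono) auto
  finally show ?thesis by (simp add: mult.assoc)
qed

lemma A_tendsto_0: "(ne_A \<rho> \<sigma> lam lamt ct st i j \<longlongrightarrow> 0) at_top"
proof (rule tendsto_0_le [OF rw_tendsto_0])
  show "eventually (\<lambda>c. norm (ne_A \<rho> \<sigma> lam lamt ct st i j c)
      \<le> norm (r c * w c) * (exp ((-1)^j * \<theta> * st) * (\<eta> / \<theta>))) at_top"
    using eventually_large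
  proof eventually_elim
    case (elim c)
    then have "r c > 0" "w c \<ge> 1" using r_pos w_ge_1 by auto
    then show ?case using A_bound [of c i j] elim by (simp add: mult_ac)
  qed
qed

lemma phi2_limit: "((\<lambda>c. ne_phi2 \<rho> \<sigma> lam lamt ct st s2 c x) \<longlongrightarrow> (s2 - x) / \<rho>) at_top"
proof -
  have "((\<lambda>c. ne_phi2 \<rho> \<sigma> lam lamt ct st s2 c x) \<longlongrightarrow>
      0 * exp (\<theta> * x) + 0 * exp (- (\<theta> * x)) + (s2 - x) / \<rho>) at_top"
    unfolding ne_phi2_def by (intro tendsto_add tendsto_mult A_tendsto_0 tendsto_const)
  then show ?thesis by simp
qed

lemma V2_limit: "((\<lambda>c. ne_V2 \<rho> \<sigma> lam lamt ct st s2 c x) \<longlongrightarrow> (s2 - x) / \<rho>) at_top"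
proof (rule Lim_transform_eventually [OF phi2_limit])
  have "eventually (\<lambda>c. ne_xbar \<rho> \<sigma> lam lamt ct st 1 c < x) at_top"
    "eventually (\<lambda>c. x < ne_xbar \<rho> \<sigma> lam lamt ct st 2 c) at_top"
    using xbar_limits by (simp_all add: filterlim_at_bot_dense filterlim_at_top_dense)
  then show "eventually (\<lambda>c. ne_phi2 \<rho> \<sigma> lam lamt ct st s2 c x
      = ne_V2 \<rho> \<sigma> lam lamt ct st s2 c x) at_top"
    by eventually_elim (simp add: ne_V2_def Let_def)
qed

lemma V1_limit: "((\<lambda>c. ne_V1 \<rho> \<sigma> lam lamt ct st s1 s2 c x) \<longlongrightarrow> (x - s1) / \<rho>) at_top"
proof -
  have "((\<lambda>c. ne_V1 \<rho> \<sigma> lam lamt ct st s1 s2 c x) \<longlongrightarrow>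
      (s2 - (2 * st - x)) / \<rho> + (2 * st - (s1 + s2)) / \<rho>) at_top"
    unfolding ne_V1_def by (intro tendsto_add V2_limit tendsto_const)
  moreover have "(s2 - (2 * st - x)) / \<rho> + (2 * st - (s1 + s2)) / \<rho> = (x - s1) / \<rho>"
    by (simp flip: add_divide_distrib)
  ultimately show ?thesis by simp
qed

end

theorem proposition4p12:
  fixes \<rho> \<sigma> s1 s2 ct lam lamt st :: real
  assumes "\<rho> > 0" and "\<sigma> > 0" and "s1 < s2" and "ct \<ge> 0"
    and "lam \<ge> lamt" and "lamt \<ge> 0" and "1 - lam * \<rho> > 0"
  shows "filterlim (\<lambda>c. ne_xbar \<rho> \<sigma> lam lamt ct st 2 c) at_top at_top
    \<and> filterlim (\<lambda>c. ne_xstar \<rho> \<sigma> lam lamt ct st 1 c) at_top at_top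
    \<and> filterlim (\<lambda>c. ne_xbar \<rho> \<sigma> lam lamt ct st 1 c) at_bot at_top
    \<and> filterlim (\<lambda>c. ne_xstar \<rho> \<sigma> lam lamt ct st 2 c) at_bot at_top
    \<and> (\<forall>x. ((\<lambda>c. ne_V1 \<rho> \<sigma> lam lamt ct st s1 s2 c x) \<longlongrightarrow> (x - s1) / \<rho>) at_top)
    \<and> (\<forall>x. ((\<lambda>c. ne_V2 \<rho> \<sigma> lam lamt ct st s2 c x) \<longlongrightarrow> (s2 - x) / \<rho>) at_top)"
proof -
  interpret impulse_game \<rho> \<sigma> ct lam lamt st
    using assms by unfold_locales
  show ?thesis
    using xbar_limits xstar_limits V1_limit V2_limit by simp
qed

end
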